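(* Consider the problem $$\begin{aligned} \text{(S)}\qquad\min_{\boldsymbol\alpha,\bar{\mathbf v},\mathbf u,\mathbf w}\ & \sum_{i_k\in\mathcal I}\big(w_{i_k}e_{i_k}(\mathbf u_{i_k},\mathbf v)-\log w_{i_k}\big)+\sum_{q_k\in\mathcal Q}\mu_{q_k}|\alpha_{q_k}|\\ \text{s.t. } & (\bar{\mathbf v}^{q_k})^H\bar{\mathbf v}^{q_k}\le P_{q_k},\qquad \alpha_{q_k}^2\le1,\qquad \forall q_k\in\mathcal Q, \end{aligned}$$ where $\mathbf v_{i_k}^{q_k}=\alpha_{q_k}\bar{\mathbf v}_{i_k}^{q_k}$ and $e_{i_k}$ is the mean square error $$e_{i_k}(\mathbf u_{i_k},\mathbf v)=(1-\mathbf u_{i_k}^H\mathbf H_{i_k}^k\mathbf v_{i_k})(1-\mathbf u_{i_k}^H\mathbf H_{i_k}^k\mathbf v_{i_k})^H+\sum_{(l,j)\ne(k,i)}\mathbf u_{i_k}^H\mathbf H_{i_k}^l\mathbf v_{j_l}\mathbf v_{j_l}^H(\mathbf H_{i_k}^l)^H\mathbf u_{i_k}+\sigma_{i_k}^2\mathbf u_{i_k}^H\mathbf u_{i_k}.$$ A block coordinate descent procedure that iteratively optimizes problem (S) over each of the block variables $\mathbf u$, $\mathbf w$, $\bar{\mathbf v}$ and $\boldsymbol\alpha$ (cyclically updating these four blocks one at a time, each time minimizing over that block with the other three fixed) can always converge to a stationary solution of problem (S).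
   Context: Network model. There are cells $\mathcal K=\{1,\dots,K\}$. Cell $k$ has a set $\mathcal Q_k$ of $Q_k$ base stations (BSs) $1_k,\dots,Q_k$ (generic: $q_k$) and a set $\mathcal I_k$ of $I_k$ users (generic: $i_k$). $\mathcal Q=\bigcup_k\mathcal Q_k$, $\mathcal I=\bigcup_k\mathcal I_k$ (disjoint unions). Each BS has $M$ transmit antennas and each user has $N$ receive antennas. The channel from BS $q_l$ to user $i_k$ is $\mathbf H_{i_k}^{q_l}\in\mathbb C^{N\times M}$, and $\mathbf H_{i_k}^l=[\mathbf H_{i_k}^{1_l},\dots,\mathbf H_{i_k}^{Q_l}]\in\mathbb C^{N\times MQ_l}$. The constants are $\sigma_{i_k}^2>0$ (noise power), $P_{q_k}>0$ (power budget) and $\mu_{q_k}\ge0$. Variables. $\boldsymbol\alpha=\{\alpha_{q_k}\in\mathbb R\}_{q_k\in\mathcal Q}$; $\bar{\mathbf v}=\{\bar{\mathbf v}_{i_k}^{q_k}\in\mathbb C^M: i_k\in\mathcal I_k,q_k\in\mathcal Q_k,k\in\mathcal K\}$; $\mathbf u=\{\mathbf u_{i_k}\in\mathbb C^N\}_{i_k\in\mathcal I}$ (receive beamformers); $\mathbf w=\{w_{i_k}\}_{i_k\in\mathcal I}$, a set of non-negative weights (necessarily positive wherever the objective, which contains $-\log w_{i_k}$, is finite). The vector $\bar{\mathbf v}^{q_k}\in\mathbb C^{MI_k}$ stacks $\bar{\mathbf v}_{i_k}^{q_k}$ over $i_k\in\mathcal I_k$; $\mathbf v_{i_k}\in\mathbb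 C^{MQ_k}$ stacks $\mathbf v_{i_k}^{q_k}=\alpha_{q_k}\bar{\mathbf v}_{i_k}^{q_k}$ over $q_k\in\mathcal Q_k$, and $\mathbf v$ is the collection of all $\mathbf v_{i_k}$. A sum over $(l,j)\ne(k,i)$ runs over all users $j_l\in\mathcal I$ other than $i_k$. Stationarity. Complex variables are identified with real ones. Let $F$ be the objective of (S), extended by $+\infty$ outside the feasible set. A point $z$ with $F(z)<\infty$ is a stationary solution of (S) if the lower directional derivative $F'(z;d)=\liminf_{\lambda\downarrow0}\frac{F(z+\lambda d)-F(z)}{\lambda}$ is nonnegative for every direction $d$. *)

theory Defs
  imports "HOL-Analysis.Analysis"
begin

text \<open>
  Base stations and users are the elements of finite types; the maps \<open>bs_cell\<close> and \<open>user_cell\<close>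
  give the partitions into cells, so the cells may have different sizes.  \<open>noise\<close> is the noise
  power (a variance), and \<open>channel i q\<close> is the channel from base station \<open>q\<close> to user \<open>i\<close>,
  with one row per receive and one column per transmit antenna.
\<close>

record ('k, 'q, 'i, 'm::finite, 'n::finite) network =
  bs_cell :: "'q \<Rightarrow> 'k"
  user_cell :: "'i \<Rightarrow> 'k"
  channel :: "'i \<Rightarrow> 'q \<Rightarrow> complex^'m^'n"
  noise :: "'i \<Rightarrow> real"
  budget :: "'q \<Rightarrow> real"
  penalty :: "'q \<Rightarrow> real"

text \<open>
  A point is \<open>(u, w, vb, a)\<close>.  The beamformer \<open>vb $ i $ q\<close> is meaningful only if \<open>i\<close> and \<open>q\<close>
  lie in the same cell; the remaining coordinates are padding, forced to zero by \<open>feasible\<close> below.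
\<close>

type_synonym ('q, 'i, 'm, 'n) point =
  "(complex^'n^'i) \<times> (real^'i) \<times> (complex^'m^'q^'i) \<times> (real^'q)"

definition hdot :: "complex^'n \<Rightarrow> complex^'n \<Rightarrow> complex" where
  "hdot x y = (\<Sum>r\<in>UNIV. cnj (x $ r) * y $ r)"

definition scaled :: "real^'q \<Rightarrow> complex^'m^'q^'i \<Rightarrow> complex^'m^'q^'i" where
  "scaled a vb = (\<chi> i q. a $ q *\<^sub>R vb $ i $ q)"

text \<open>
  The signal for user \<open>j\<close> as received by user \<open>i\<close>: the product of the block row of channels
  from the base stations in the cell of \<open>j\<close> with the stacked beamformer of \<open>j\<close>.
\<close>

definition received ::
  "('k, 'q::finite, 'i::finite, 'm::finite, 'n::finite) network
    \<Rightarrow> 'i \<Rightarrow> 'i \<Rightarrow> complex^'m^'q^'i \<Rightarrow> complex^'n" where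
  "received N i j v =
     (\<Sum>q | bs_cell N q = user_cell N j. channel N i q *v (v $ j $ q))"

text \<open>For a scalar \<open>z\<close>, the product of \<open>z\<close> with its adjoint is \<open>(cmod z)\<^sup>2\<close>.\<close>

definition mse ::
  "('k, 'q::finite, 'i::finite, 'm::finite, 'n::finite) network
    \<Rightarrow> 'i \<Rightarrow> complex^'n \<Rightarrow> complex^'m^'q^'i \<Rightarrow> real" where
  "mse N i ui v =
     (cmod (1 - hdot ui (received N i i v)))\<^sup>2
     + (\<Sum>j\<in>UNIV - {i}. (cmod (hdot ui (received N i j v)))\<^sup>2)
     + noise N i * (norm ui)\<^sup>2"

definition feasible ::
  "('k, 'q::finite, 'i::finite, 'm::finite, 'n::finite) network
    \<Rightarrow> ('q, 'i, 'm, 'n) point \<Rightarrow> bool" where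
  "feasible N = (\<lambda>(u, w, vb, a).
     (\<forall>i. 0 \<le> w $ i)
     \<and> (\<forall>q. (\<Sum>i | user_cell N i = bs_cell N q. (norm (vb $ i $ q))\<^sup>2) \<le> budget N q)
     \<and> (\<forall>q. (a $ q)\<^sup>2 \<le> 1)
     \<and> (\<forall>i q. user_cell N i \<noteq> bs_cell N q \<longrightarrow> vb $ i $ q = 0))"

text \<open>
  The objective, extended by \<open>\<infinity>\<close> outside the feasible set.  The separate test for \<open>0 < w $ i\<close>
  is needed because \<open>- log 0\<close> stands for \<open>\<infinity>\<close>, whereas \<open>ln 0 = 0\<close> in HOL.
\<close>

definition objective ::
  "('k, 'q::finite, 'i::finite, 'm::finite, 'n::finite) network
    \<Rightarrow> ('q, 'i, 'm, 'n) point \<Rightarrow> ereal" where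
  "objective N = (\<lambda>(u, w, vb, a).
     if feasible N (u, w, vb, a) \<and> (\<forall>i. 0 < w $ i)
     then ereal ((\<Sum>i\<in>UNIV. w $ i * mse N i (u $ i) (scaled a vb) - ln (w $ i))
                 + (\<Sum>q\<in>UNIV. penalty N q * \<bar>a $ q\<bar>))
     else \<infinity>)"

definition lower_dir_deriv :: "('a::real_vector \<Rightarrow> ereal) \<Rightarrow> 'a \<Rightarrow> 'a \<Rightarrow> ereal" where
  "lower_dir_deriv f z d =
     Liminf (at_right 0) (\<lambda>t::real. (f (z + t *\<^sub>R d) - f z) / ereal t)"

definition stationary_point :: "('a::real_vector \<Rightarrow> ereal) \<Rightarrow> 'a \<Rightarrow> bool" where
  "stationary_point f z \<longleftrightarrow> f z < \<infinity> \<and> (\<forall>d. 0 \<le> lower_dir_deriv f z d)"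

text \<open>
  One full cycle over the four blocks, in the order \<open>u\<close>, \<open>w\<close>, \<open>vb\<close>, \<open>a\<close>.  Minimizers need not
  be unique, so this is a relation: any minimizer may be chosen in each block.
\<close>

definition bcd_cycle ::
  "('k, 'q::finite, 'i::finite, 'm::finite, 'n::finite) network
    \<Rightarrow> ('q, 'i, 'm, 'n) point \<Rightarrow> ('q, 'i, 'm, 'n) point \<Rightarrow> bool" where
  "bcd_cycle N = (\<lambda>(u, w, vb, a) (u', w', vb', a').
     is_arg_min (\<lambda>x. objective N (x, w, vb, a)) (\<lambda>_. True) u'
     \<and> is_arg_min (\<lambda>x. objective N (u', x, vb, a)) (\<lambda>_. True) w'
     \<and> is_arg_min (\<lambda>x. objective N (u', w', x, a)) (\<lambda>_. True) vb'
     \<and> is_arg_min (\<lambda>x. objective N (u', w', vb', x)) (\<lambda>_. True) a')"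

definition bcd_run ::
  "('k, 'q::finite, 'i::finite, 'm::finite, 'n::finite) network
    \<Rightarrow> (nat \<Rightarrow> ('q, 'i, 'm, 'n) point) \<Rightarrow> bool" where
  "bcd_run N x \<longleftrightarrow> feasible N (x 0) \<and> (\<forall>t. bcd_cycle N (x t) (x (Suc t)))"

text \<open>
  Convergence to the solution set \<open>S\<close> in the sense usual for descent methods: limit points exist,
  they all lie in \<open>S\<close>, and the distance of the iterates to \<open>S\<close> vanishes.  (The iterates
  themselves need not converge: if \<open>a $ q = 0\<close>, then \<open>vb $ i $ q\<close> is arbitrary.)
\<close>

definition converges_to_set :: "(nat \<Rightarrow> 'a::metric_space) \<Rightarrow> 'a set \<Rightarrow> bool" where
  "converges_to_set x S \<longleftrightarrow>
     bounded (range x)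
     \<and> (\<exists>z r. strict_mono r \<and> (x \<circ> r) \<longlonglongrightarrow> z)
     \<and> (\<forall>z r. strict_mono r \<and> (x \<circ> r) \<longlonglongrightarrow> z \<longrightarrow> z \<in> S)
     \<and> (\<lambda>t. infdist (x t) S) \<longlonglongrightarrow> 0"

end

theory Submission
  imports Defs
begin

text \<open>
  The constraints are blockwise, and the minimizers in \<open>u\<close> and \<open>w\<close> are unique: the mean square
  errors are strictly convex in \<open>u\<close>, and the optimal weights are their reciprocals.  From the second
  cycle on every mean square error is at most that of \<open>u = 0\<close>, which is \<open>1\<close>; this bounds \<open>u\<close> and
  keeps the weights at least \<open>1\<close>, away from the singularity of the logarithm.  A cluster point is
  the limit of iterates; the cycles before and after it, together with the equality of the limiting
  objective values, show that it is minimal in each block separately.  As the coupled part of the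
  objective is differentiable, blockwise minimality gives stationarity.
\<close>

section \<open>Blockwise minimizers and cluster points\<close>

text \<open>If the distances did not vanish, some subsequence would stay at distance at least
  \<open>e\<close> from \<open>S\<close>; by boundedness it has a convergent further subsequence,
  whose limit lies in \<open>S\<close>.\<close>

lemma converges_to_setI:
  fixes x :: "nat \<Rightarrow> 'a::heine_borel"
  assumes bnd: "bounded (range x)"
    and cluster: "\<And>z r. strict_mono r \<Longrightarrow> (x \<circ> r) \<longlonglongrightarrow> z \<Longrightarrow> z \<in> S"
  shows "converges_to_set x S"
proof -
  have ex: "\<exists>z r. strict_mono r \<and> (x \<circ> r) \<longlonglongrightarrow> z"
    using bounded_imp_convergent_subsequence[OF bnd] by blast
  have "(\<lambda>t. infdist (x t) S) \<longlonglongrightarrow> 0"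
  proof (rule ccontr)
    assume "\<not> ?thesis"
    then obtain e where e: "e > 0" and freq: "\<forall>n. \<exists>t\<ge>n. e \<le> infdist (x t) S"
      unfolding lim_sequentially by (force simp: not_less infdist_nonneg)
    have "infinite {t. e \<le> infdist (x t) S}"
      unfolding infinite_nat_iff_unbounded_le using freq by auto
    from infinite_enumerate[OF this] obtain s :: "nat \<Rightarrow> nat"
      where s: "strict_mono s" and far: "\<And>n. e \<le> infdist (x (s n)) S"
      by auto
    have "bounded (range (x \<circ> s))"
      using bnd by (rule bounded_subset) auto
    from bounded_imp_convergent_subsequence[OF this]
    obtain z r where r: "strict_mono r" and lim: "(x \<circ> s \<circ> r) \<longlonglongrightarrow> z"
      by blast
    have z: "z \<in> S"
      using cluster[of "s \<circ> r" z] lim s r by (simp add: o_assoc strict_mono_o)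
    obtain n where "dist ((x \<circ> s \<circ> r) n) z < e"
      using lim e unfolding lim_sequentially by blast
    moreover have "infdist (x (s (r n))) S \<le> dist (x (s (r n))) z"
      by (rule infdist_le[OF z])
    ultimately show False
      using far[of "r n"] by simp
  qed
  then show ?thesis
    unfolding converges_to_set_def using bnd ex cluster by blast
qed

text \<open>For empty \<open>S\<close> the function would be constantly infinite and every point a
  minimizer; nonemptiness excludes this.\<close>

lemma is_arg_min_extended_iff:
  assumes "S \<noteq> {}"
  shows "is_arg_min (\<lambda>x. if x \<in> S then ereal (h x) else \<infinity>) (\<lambda>_. True) y
    \<longleftrightarrow> y \<in> S \<and> (\<forall>x\<in>S. h y \<le> h x)"
  using assms by (auto simp: is_arg_min_def not_less split: if_splits)

text \<open>The error \<open>t * p t\<close> is o(t) and disappears in the difference quotient;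
  where the ray meets the value infinity, the quotient is infinite and the bound is
  automatic.\<close>

lemma lower_dir_deriv_nonneg:
  assumes "F z = ereal c"
    and le: "\<And>t. 0 < t \<Longrightarrow> F (z + t *\<^sub>R d) \<noteq> \<infinity> \<Longrightarrow> ereal (c + t * p t) \<le> F (z + t *\<^sub>R d)"
    and "(p \<longlongrightarrow> 0) (at_right 0)"
  shows "0 \<le> lower_dir_deriv F z d"
proof -
  have "((\<lambda>t. ereal (p t)) \<longlongrightarrow> 0) (at_right 0)"
    using assms(3) by (simp add: zero_ereal_def)
  then have "0 = Liminf (at_right 0) (\<lambda>t. ereal (p t))"
    by (simp add: lim_imp_Liminf)
  also have "\<dots> \<le> lower_dir_deriv F z d"
    unfolding lower_dir_deriv_def
  proof (rule Liminf_mono)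
    have "ereal (p t) \<le> (F (z + t *\<^sub>R d) - F z) / ereal t" if "0 < t" for t
      using le[OF that] that assms(1)
      by (cases "F (z + t *\<^sub>R d)") (auto simp: field_simps)
    then show "\<forall>\<^sub>F t in at_right 0. ereal (p t) \<le> (F (z + t *\<^sub>R d) - F z) / ereal t"
      by (auto simp: eventually_at_filter)
  qed
  finally show ?thesis .
qed

text \<open>
  No convexity is needed: at a point of differentiability the increment of \<open>f\<close> in direction \<open>d\<close>
  is the sum of the increments along the block components of \<open>d\<close>, up to \<open>o(t)\<close>.
\<close>

lemma blockwise_min_stationary:
  fixes f :: "'a::real_normed_vector \<times> 'b::real_normed_vector \<times> 'c::real_normed_vector
      \<times> 'd::real_normed_vector \<Rightarrow> real"
  assumes F: "\<And>u w v a. F (u, w, v, a) =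
      (if w \<in> W \<and> v \<in> V \<and> a \<in> A then ereal (f (u, w, v, a) + g a) else \<infinity>)"
    and diff: "f differentiable (at (u, w, v, a))"
    and mem: "w \<in> W" "v \<in> V" "a \<in> A"
    and min_u: "\<And>y. f (u, w, v, a) \<le> f (y, w, v, a)"
    and min_w: "\<And>y. y \<in> W \<Longrightarrow> f (u, w, v, a) \<le> f (u, y, v, a)"
    and min_v: "\<And>y. y \<in> V \<Longrightarrow> f (u, w, v, a) \<le> f (u, w, y, a)"
    and min_a: "\<And>y. y \<in> A \<Longrightarrow> f (u, w, v, a) + g a \<le> f (u, w, v, y) + g y"
  shows "stationary_point F (u, w, v, a)"
proof -
  let ?z = "(u, w, v, a)"
  obtain D where D: "(f has_derivative D) (at ?z)"
    using diff unfolding differentiable_def by blast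
  then have lin: "linear D"
    by (rule has_derivative_linear)
  have quot: "((\<lambda>t. (f (?z + t *\<^sub>R d) - f ?z) / t) \<longlongrightarrow> D d) (at_right 0)" for d
  proof -
    have "((\<lambda>t::real. ?z + t *\<^sub>R d) has_derivative (\<lambda>t. t *\<^sub>R d)) (at 0)"
      by (auto intro!: derivative_eq_intros)
    then have "((\<lambda>t. f (?z + t *\<^sub>R d)) has_derivative (\<lambda>t. D (t *\<^sub>R d))) (at 0)"
      using has_derivative_compose[of "\<lambda>t. ?z + t *\<^sub>R d" _ 0 UNIV f D] D by simp
    then have "((\<lambda>t. f (?z + t *\<^sub>R d)) has_real_derivative D d) (at 0)"
      by (simp add: linear_scale[OF lin] has_field_derivative_def mult_commute_abs)
    then show ?thesis
      by (auto simp: DERIV_def intro: tendsto_mono[OF at_le])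
  qed
  have "0 \<le> lower_dir_deriv F ?z d" for d
  proof -
    obtain du dw dv da where d: "d = (du, dw, dv, da)"
      by (cases d) auto
    define q where "q d' t = (f (?z + t *\<^sub>R d') - f ?z) / t" for d' t
    let ?du = "(du, 0, 0, 0)" and ?dw = "(0, dw, 0, 0)" and ?dv = "(0, 0, dv, 0)"
      and ?da = "(0, 0, 0, da)"
    \<comment> \<open>\<open>p\<close> is what remains of the difference quotient after removing
      those along the four block directions; additivity of \<open>D\<close> makes it tend to
      0.\<close>
    define p where "p t = q d t - q ?du t - q ?dw t - q ?dv t - q ?da t" for t
    have "d = ?du + ?dw + ?dv + ?da"
      by (simp add: d)
    then have "D d = D ?du + D ?dw + D ?dv + D ?da"
      by (simp only: linear_add[OF lin])
    moreover have "(p \<longlongrightarrow> D d - D ?du - D ?dw - D ?dv - D ?da) (at_right 0)"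
      unfolding p_def q_def by (intro tendsto_diff quot)
    ultimately have p: "(p \<longlongrightarrow> 0) (at_right 0)"
      by simp
    show ?thesis
    proof (rule lower_dir_deriv_nonneg[where c = "f ?z + g a" and p = p])
      show "F ?z = ereal (f ?z + g a)"
        using mem by (simp add: F)
      fix t :: real
      assume t: "0 < t" and "F (?z + t *\<^sub>R d) \<noteq> \<infinity>"
      \<comment> \<open>The constraints form a product, so feasibility of the whole displacement
        gives feasibility of each block displacement.\<close>
      then have mem': "w + t *\<^sub>R dw \<in> W" "v + t *\<^sub>R dv \<in> V" "a + t *\<^sub>R da \<in> A"
        by (auto simp: d F split: if_splits)
      have tq: "t * q d' t = f (?z + t *\<^sub>R d') - f ?z" for d'
        using t by (simp add: q_def)
      have "t * p t = t * q d t - t * q ?du t - t * q ?dw t - t * q ?dv t - t * q ?da t"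
        by (simp add: p_def right_diff_distrib)
      \<comment> \<open>Block minimality makes the first three block increments nonnegative; the
        fourth is at least \<open>g a\<close> minus the value of \<open>g\<close> at the displaced
        point.\<close>
      also have "\<dots> \<le> f (?z + t *\<^sub>R d) - f ?z + g (a + t *\<^sub>R da) - g a"
        unfolding tq using min_u[of "u + t *\<^sub>R du"] min_w[OF mem'(1)] min_v[OF mem'(2)]
          min_a[OF mem'(3)] by simp
      finally show "ereal (f ?z + g a + t * p t) \<le> F (?z + t *\<^sub>R d)"
        using mem' by (simp add: d F)
    qed (rule p)
  qed
  then show ?thesis
    using mem by (auto simp: stationary_point_def F)
qed

text \<open>
  Uniqueness of the minimizers is only required in the first two blocks: minimality of the limit
  in the third block is inherited from the limit of the following iterates, which by uniqueness
  has the same first two components, and minimality in the fourth from the preceding cycle.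
\<close>

lemma bcd_cluster_point:
  fixes F :: "'a::heine_borel \<times> 'b::heine_borel \<times> 'c::heine_borel \<times> 'd::heine_borel \<Rightarrow> real"
  assumes cont: "continuous_on (UNIV \<times> W \<times> V \<times> A) F"
    and closed: "closed W'" "W' \<subseteq> W" "closed V" "closed A"
    and mem: "\<And>t. w t \<in> W'" "\<And>t. v t \<in> V" "\<And>t. a t \<in> A"
    and bnd: "bounded (range (\<lambda>t. (u t, w t, v t, a t)))"
    and step_u: "\<And>t y. F (u (Suc t), w t, v t, a t) \<le> F (y, w t, v t, a t)"
    and step_w: "\<And>t y. y \<in> W \<Longrightarrow> F (u (Suc t), w (Suc t), v t, a t) \<le> F (u (Suc t), y, v t, a t)"
    and step_v: "\<And>t y. y \<in> V \<Longrightarrow>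
      F (u (Suc t), w (Suc t), v (Suc t), a t) \<le> F (u (Suc t), w (Suc t), y, a t)"
    and step_a: "\<And>t y. y \<in> A \<Longrightarrow>
      F (u (Suc t), w (Suc t), v (Suc t), a (Suc t)) \<le> F (u (Suc t), w (Suc t), v (Suc t), y)"
    and uniq_u: "\<And>u u' w v a. w \<in> W \<Longrightarrow> v \<in> V \<Longrightarrow> a \<in> A \<Longrightarrow>
      (\<And>y. F (u, w, v, a) \<le> F (y, w, v, a)) \<Longrightarrow> F (u', w, v, a) = F (u, w, v, a) \<Longrightarrow> u' = u"
    and uniq_w: "\<And>u w w' v a. w \<in> W \<Longrightarrow> w' \<in> W \<Longrightarrow> v \<in> V \<Longrightarrow> a \<in> A \<Longrightarrow>
      (\<And>y. y \<in> W \<Longrightarrow> F (u, w, v, a) \<le> F (u, y, v, a)) \<Longrightarrow> F (u, w', v, a) = F (u, w, v, a) \<Longrightarrow> w' = w"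
    and r: "strict_mono r"
    and lim: "(\<lambda>n. (u (r n), w (r n), v (r n), a (r n))) \<longlonglongrightarrow> (u0, w0, v0, a0)"
  shows "w0 \<in> W' \<and> v0 \<in> V \<and> a0 \<in> A \<and> (\<forall>y. F (u0, w0, v0, a0) \<le> F (y, w0, v0, a0))
    \<and> (\<forall>y\<in>W. F (u0, w0, v0, a0) \<le> F (u0, y, v0, a0))
    \<and> (\<forall>y\<in>V. F (u0, w0, v0, a0) \<le> F (u0, w0, y, a0))
    \<and> (\<forall>y\<in>A. F (u0, w0, v0, a0) \<le> F (u0, w0, v0, y))"
proof -
  define x where "x t = (u t, w t, v t, a t)" for t
  \<comment> \<open>The outer \<open>Suc\<close> passes to the iterates one cycle later; the inner
    one keeps the index positive, so that a preceding cycle exists as well.\<close>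
  have "bounded (range (x \<circ> (Suc \<circ> r \<circ> Suc)))"
    using bnd by (rule bounded_subset) (auto simp: x_def)
  from bounded_imp_convergent_subsequence[OF this] obtain z s where s: "strict_mono s"
    and zlim: "(x \<circ> (Suc \<circ> r \<circ> Suc) \<circ> s) \<longlonglongrightarrow> z" by blast
  obtain u1 w1 v1 a1 where z: "z = (u1, w1, v1, a1)"
    by (cases z) auto
  define m where "m n = r (Suc (s n))" for n
  have m: "strict_mono m"
    using r s unfolding m_def strict_mono_def by auto
  have mpos: "m n \<noteq> 0" for n
    using strict_mono_imp_increasing[OF r, of "Suc (s n)"] by (simp add: m_def)
  have "(\<lambda>n. (u (m n), w (m n), v (m n), a (m n))) \<longlonglongrightarrow> (u0, w0, v0, a0)"
    using LIMSEQ_subseq_LIMSEQ[OF lim, of "Suc \<circ> s"] s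
    by (simp add: m_def o_def strict_mono_def)
  from this this[THEN tendsto_snd] this[THEN tendsto_snd, THEN tendsto_snd]
  have lim0: "(\<lambda>n. u (m n)) \<longlonglongrightarrow> u0" "(\<lambda>n. w (m n)) \<longlonglongrightarrow> w0"
    "(\<lambda>n. v (m n)) \<longlonglongrightarrow> v0" "(\<lambda>n. a (m n)) \<longlonglongrightarrow> a0"
    by (auto dest: tendsto_fst tendsto_snd)
  have "(\<lambda>n. (u (Suc (m n)), w (Suc (m n)), v (Suc (m n)), a (Suc (m n)))) \<longlonglongrightarrow> (u1, w1, v1, a1)"
    using zlim by (simp add: x_def m_def o_def z)
  from this this[THEN tendsto_snd] this[THEN tendsto_snd, THEN tendsto_snd]
  have lim1: "(\<lambda>n. u (Suc (m n))) \<longlonglongrightarrow> u1" "(\<lambda>n. w (Suc (m n))) \<longlonglongrightarrow> w1"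
    "(\<lambda>n. v (Suc (m n))) \<longlonglongrightarrow> v1" "(\<lambda>n. a (Suc (m n))) \<longlonglongrightarrow> a1"
    by (auto dest: tendsto_fst tendsto_snd)
  have "w0 \<in> W'" "w1 \<in> W'"
    using closed_sequentially[OF closed(1) mem(1) lim0(2)]
      closed_sequentially[OF closed(1) mem(1) lim1(2)] .
  note memW = this this[THEN subsetD[OF closed(2)]] mem(1)[THEN subsetD[OF closed(2)]]
  note mems = memW mem(2,3)
    closed_sequentially[OF closed(3) mem(2) lim0(3)]
    closed_sequentially[OF closed(4) mem(3) lim0(4)]
    closed_sequentially[OF closed(3) mem(2) lim1(3)]
    closed_sequentially[OF closed(4) mem(3) lim1(4)]
  \<comment> \<open>Comparisons between iterates survive in the limit because all points, limits
    included, stay where \<open>F\<close> is continuous.\<close>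
  have lim_le: "F (u, w, v, a) \<le> F (u', w', v', a')"
    if "U \<longlonglongrightarrow> u" "X \<longlonglongrightarrow> w" "Y \<longlonglongrightarrow> v" "Z \<longlonglongrightarrow> a"
      "U' \<longlonglongrightarrow> u'" "X' \<longlonglongrightarrow> w'" "Y' \<longlonglongrightarrow> v'" "Z' \<longlonglongrightarrow> a'"
      "\<And>n::nat. F (U n, X n, Y n, Z n) \<le> F (U' n, X' n, Y' n, Z' n)"
      "\<And>n. X n \<in> W" "\<And>n. Y n \<in> V" "\<And>n. Z n \<in> A"
      "\<And>n. X' n \<in> W" "\<And>n. Y' n \<in> V" "\<And>n. Z' n \<in> A"
      "w \<in> W" "v \<in> V" "a \<in> A" "w' \<in> W" "v' \<in> V" "a' \<in> A"
    for U X Y Z U' X' Y' Z' u w v a u' w' v' a'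
  proof (rule LIMSEQ_le)
    show "(\<lambda>n. F (U n, X n, Y n, Z n)) \<longlonglongrightarrow> F (u, w, v, a)"
      by (rule continuous_on_tendsto_compose[OF cont tendsto_Pair[OF that(1) tendsto_Pair[OF that(2)
              tendsto_Pair[OF that(3,4)]]]]) (simp_all add: that)
    show "(\<lambda>n. F (U' n, X' n, Y' n, Z' n)) \<longlonglongrightarrow> F (u', w', v', a')"
      by (rule continuous_on_tendsto_compose[OF cont tendsto_Pair[OF that(5) tendsto_Pair[OF that(6)
              tendsto_Pair[OF that(7,8)]]]]) (simp_all add: that)
  qed (simp add: that(9))
  have decr: "F (x (Suc t)) \<le> F (x t)" for t
    unfolding x_def
    using step_u[of t "u t"] step_w[OF memW(5), of t t] step_v[OF mem(2), of t t]
      step_a[OF mem(3), of t t] by linarith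
  then have anti: "F (x t') \<le> F (x t)" if "t \<le> t'" for t t'
    using that by (rule lift_Suc_antimono_le)
  have min_u1: "F (u1, w0, v0, a0) \<le> F (y, w0, v0, a0)" for y
    by (rule lim_le[OF lim1(1) lim0(2-4) tendsto_const lim0(2-4)]) (simp_all add: mems step_u)
  have min_w1: "F (u1, w1, v0, a0) \<le> F (u1, y, v0, a0)" if "y \<in> W" for y
    by (rule lim_le[OF lim1(1,2) lim0(3,4) lim1(1) tendsto_const lim0(3,4)])
      (simp_all add: mems that step_w)
  have min_v1: "F (u1, w1, v1, a0) \<le> F (u1, w1, y, a0)" if "y \<in> V" for y
    by (rule lim_le[OF lim1(1-3) lim0(4) lim1(1,2) tendsto_const lim0(4)])
      (simp_all add: mems that step_v)
  have min_a1: "F (u1, w1, v1, a1) \<le> F (u1, w1, v1, y)" if "y \<in> A" for y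
    by (rule lim_le[OF lim1 lim1(1-3) tendsto_const]) (simp_all add: mems that step_a)
  \<comment> \<open>The last block of iterate \<open>m n\<close> was chosen in the cycle before, at
    index \<open>m n - 1\<close>.\<close>
  have step_a': "F (u (m n), w (m n), v (m n), a (m n)) \<le> F (u (m n), w (m n), v (m n), y)"
    if "y \<in> A" for y n
    using step_a[OF that, of "m n - 1"] mpos[of n] by simp
  have min_a0: "F (u0, w0, v0, a0) \<le> F (u0, w0, v0, y)" if "y \<in> A" for y
    by (rule lim_le[OF lim0 lim0(1-3) tendsto_const]) (simp_all add: mems that step_a')
  \<comment> \<open>Values do not increase from \<open>Suc (m n)\<close> to
    \<open>m (Suc n)\<close>, so the limit along the successors has at least the value of the
    original limit.\<close>
  have "Suc (m n) \<le> m (Suc n)" for n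
    using m by (simp add: strict_mono_def Suc_le_eq)
  note anti' = anti[OF this, unfolded x_def]
  have "F (u0, w0, v0, a0) \<le> F (u1, w1, v1, a1)"
    by (rule lim_le[OF lim0[THEN LIMSEQ_Suc] lim1]) (simp_all add: mems anti')
  \<comment> \<open>The block inequalities descend from the value at the first limit to that at the
    second, which is not smaller; hence all of them are equalities.\<close>
  then have eq: "F (u0, w0, v0, a0) = F (u1, w0, v0, a0)" "F (u1, w0, v0, a0) = F (u1, w1, v0, a0)"
    "F (u1, w1, v0, a0) = F (u1, w1, v1, a0)"
    using min_u1[of u0] min_w1[of w0] min_v1[of v0] min_a1[of a0] mems by simp_all
  have u: "u0 = u1"
    by (rule uniq_u[OF _ _ _ min_u1 eq(1)]) (simp_all add: mems)
  have w: "w0 = w1"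
    by (rule uniq_w[OF _ _ _ _ min_w1]) (simp_all add: mems eq)
  \<comment> \<open>With the first two blocks equal, minimality of \<open>v1\<close> passes to
    \<open>v0\<close> because their values agree.\<close>
  show ?thesis
    using mems min_u1 min_w1 min_v1 min_a0 by (simp add: eq u w)
qed

section \<open>The mean square error\<close>

lemma differentiable_bounded_linear:
  "bounded_linear h \<Longrightarrow> f differentiable F \<Longrightarrow> (\<lambda>x. h (f x)) differentiable F"
  unfolding differentiable_def by (blast intro: bounded_linear.has_derivative)

lemma differentiable_vec_nth: "f differentiable F \<Longrightarrow> (\<lambda>x. f x $ i) differentiable F"
  by (rule differentiable_bounded_linear[OF bounded_linear_vec_nth])

lemma bounded_vecI:
  fixes S :: "('a::real_normed_vector^'n) set"
  assumes "\<And>x i. x \<in> S \<Longrightarrow> norm (x $ i) \<le> B i"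
  shows "bounded S"
proof (rule boundedI)
  fix x assume "x \<in> S"
  have "norm x \<le> (\<Sum>i\<in>UNIV. norm (x $ i))"
    unfolding norm_vec_def by (rule L2_set_le_sum) simp
  also have "\<dots> \<le> (\<Sum>i\<in>UNIV. B i)"
    using assms[OF \<open>x \<in> S\<close>] by (rule sum_mono)
  finally show "norm x \<le> (\<Sum>i\<in>UNIV. B i)" .
qed

text \<open>The parallelogram law in midpoint form; the subtracted term is the gap behind strict
  convexity.\<close>

lemma norm_midpoint_square:
  fixes x y :: "'a::real_inner"
  shows "(norm ((1/2) *\<^sub>R (x + y)))\<^sup>2 = ((norm x)\<^sup>2 + (norm y)\<^sup>2) / 2 - (norm (x - y))\<^sup>2 / 4"
  by (simp add: power2_norm_eq_inner inner_add_left inner_add_right inner_diff_left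
      inner_diff_right inner_commute field_simps)

lemma norm_midpoint_square_le:
  fixes x y :: "'a::real_inner"
  shows "(norm ((1/2) *\<^sub>R (x + y)))\<^sup>2 \<le> ((norm x)\<^sup>2 + (norm y)\<^sup>2) / 2"
  unfolding norm_midpoint_square using zero_le_power2[of "norm (x - y)"] by linarith

section \<open>Optimal weights for given errors\<close>

text \<open>The inequality \<open>ln x \<le> x - 1\<close> at \<open>x = w * e\<close>.\<close>

lemma ln_cost_ge:
  fixes e w :: real
  assumes "0 < e" "0 < w"
  shows "1 + ln e \<le> w * e - ln w"
  using ln_le_minus_one[of "w * e"] assms by (simp add: ln_mult)

text \<open>Equality in \<open>ln x \<le> x - 1\<close> holds only at \<open>x = 1\<close>.\<close>

lemma ln_cost_eqD:
  fixes e w :: real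
  assumes "0 < e" "0 < w" "w * e - ln w = 1 + ln e"
  shows "w * e = 1"
  using ln_eq_minus_one[of "w * e"] assms by (simp add: ln_mult)

text \<open>Both directions compare with the sum of \<open>1 + ln (e $ i)\<close>, attained at the
  reciprocals of the \<open>e $ i\<close>; equal sums of termwise ordered summands force every term
  to be minimal.\<close>

lemma weights_min_iff:
  fixes e w :: "real^'i"
  assumes e: "\<And>i. 0 < e $ i" and w: "\<And>i. 0 < w $ i"
  shows "(\<forall>y. (\<forall>i. 0 < y $ i) \<longrightarrow> (\<Sum>i\<in>UNIV. w $ i * e $ i - ln (w $ i)) \<le> (\<Sum>i\<in>UNIV. y $ i * e $ i - ln (y $ i)))
    \<longleftrightarrow> (\<forall>i. w $ i * e $ i = 1)" (is "?L \<longleftrightarrow> ?R")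
proof
  assume L: ?L
  define y where "y = (\<chi> i. 1 / e $ i)"
  have y: "y $ i * e $ i - ln (y $ i) = 1 + ln (e $ i)" "0 < y $ i" for i
    using e[of i] by (auto simp: y_def ln_div)
  have "(\<Sum>i\<in>UNIV. w $ i * e $ i - ln (w $ i)) \<le> (\<Sum>i\<in>UNIV. 1 + ln (e $ i))"
    using L[rule_format, of y] y by simp
  moreover have "(\<Sum>i\<in>UNIV. 1 + ln (e $ i)) \<le> (\<Sum>i\<in>UNIV. w $ i * e $ i - ln (w $ i))"
    by (intro sum_mono ln_cost_ge e w)
  ultimately have eq: "(\<Sum>i\<in>UNIV. 1 + ln (e $ i)) = (\<Sum>i\<in>UNIV. w $ i * e $ i - ln (w $ i))"
    by simp
  show ?R
  proof
    fix i
    have "1 + ln (e $ i) = w $ i * e $ i - ln (w $ i)"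
      by (rule sum_mono_inv[OF eq]) (simp_all add: ln_cost_ge e w)
    then show "w $ i * e $ i = 1"
      by (intro ln_cost_eqD[OF e w]) simp
  qed
next
  assume R: ?R
  have "w $ i * e $ i - ln (w $ i) = 1 + ln (e $ i)" for i
    using R[rule_format, of i] ln_mult_pos[OF w e, of i i] by simp
  then show ?L
    by (auto intro!: sum_mono ln_cost_ge e)
qed

section \<open>Positivity, strict convexity and differentiability of the mean square error\<close>

lemma hdot_add_left: "hdot (x + y) z = hdot x z + hdot y z"
  by (simp add: hdot_def algebra_simps sum.distrib)

lemma hdot_scaleR_left: "hdot (c *\<^sub>R x) z = c *\<^sub>R hdot x z"
  by (simp add: hdot_def scaleR_sum_right)

lemma mse_0 [simp]: "mse N i 0 v = 1"
  by (simp add: mse_def hdot_def)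

lemma mse_ge_noise: "noise N i * (norm x)\<^sup>2 \<le> mse N i x v"
  by (simp add: mse_def sum_nonneg)

lemma mse_pos:
  assumes "0 < noise N i"
  shows "0 < mse N i x v"
proof (cases "x = 0")
  case False
  then have "0 < noise N i * (norm x)\<^sup>2"
    using assms by simp
  then show ?thesis
    using mse_ge_noise[of N i x v] by linarith
qed simp

text \<open>Squared moduli of real-affine functions are convex; strictness comes from the noise
  term, whose factor is positive.\<close>

lemma mse_midpoint_less:
  assumes "0 < noise N i" "x \<noteq> y"
  shows "mse N i ((1/2) *\<^sub>R (x + y)) v < (mse N i x v + mse N i y v) / 2"
proof -
  let ?h = "\<lambda>j x. hdot x (received N i j v)" and ?m = "(1/2) *\<^sub>R (x + y)"
  \<comment> \<open>\<open>hdot\<close> is conjugate-linear on the left, hence linear over the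
    reals, and so respects midpoints.\<close>
  have h: "?h j ?m = (1/2) *\<^sub>R (?h j x + ?h j y)" for j
    by (simp only: hdot_add_left hdot_scaleR_left)
  have h': "1 - ?h j ?m = (1/2) *\<^sub>R ((1 - ?h j x) + (1 - ?h j y))" for j
    unfolding h by (simp add: scaleR_conv_of_real field_simps)
  have "(norm ?m)\<^sup>2 < ((norm x)\<^sup>2 + (norm y)\<^sup>2) / 2"
  proof -
    have "0 < (norm (x - y))\<^sup>2"
      using assms(2) by simp
    then show ?thesis
      unfolding norm_midpoint_square by linarith
  qed
  then have "noise N i * (norm ?m)\<^sup>2 < noise N i * (((norm x)\<^sup>2 + (norm y)\<^sup>2) / 2)"
    using assms(1) by (rule mult_strict_left_mono)
  moreover have "(\<Sum>j\<in>UNIV - {i}. (cmod (?h j ?m))\<^sup>2)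
      \<le> (\<Sum>j\<in>UNIV - {i}. ((cmod (?h j x))\<^sup>2 + (cmod (?h j y))\<^sup>2) / 2)"
    unfolding h by (intro sum_mono norm_midpoint_square_le)
  moreover have "(cmod (1 - ?h i ?m))\<^sup>2 \<le> ((cmod (1 - ?h i x))\<^sup>2 + (cmod (1 - ?h i y))\<^sup>2) / 2"
    unfolding h' by (rule norm_midpoint_square_le)
  moreover have "(\<Sum>j\<in>UNIV - {i}. ((cmod (?h j x))\<^sup>2 + (cmod (?h j y))\<^sup>2) / 2)
      = ((\<Sum>j\<in>UNIV - {i}. (cmod (?h j x))\<^sup>2) + (\<Sum>j\<in>UNIV - {i}. (cmod (?h j y))\<^sup>2)) / 2"
    by (simp add: sum.distrib sum_divide_distrib add_divide_distrib)
  ultimately have "mse N i ?m v < ((cmod (1 - ?h i x))\<^sup>2 + (cmod (1 - ?h i y))\<^sup>2) / 2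
      + ((\<Sum>j\<in>UNIV - {i}. (cmod (?h j x))\<^sup>2) + (\<Sum>j\<in>UNIV - {i}. (cmod (?h j y))\<^sup>2)) / 2
      + noise N i * (((norm x)\<^sup>2 + (norm y)\<^sup>2) / 2)"
    unfolding mse_def by linarith
  also have "\<dots> = (mse N i x v + mse N i y v) / 2"
    by (simp add: mse_def field_simps)
  finally show ?thesis .
qed

lemma mse_minimizer_unique:
  assumes "0 < noise N i" "\<And>z. mse N i x v \<le> mse N i z v" "\<And>z. mse N i y v \<le> mse N i z v"
  shows "x = y"
proof (rule ccontr)
  define m where "m = (1/2::real) *\<^sub>R (x + y)"
  assume "x \<noteq> y"
  then have "mse N i m v < (mse N i x v + mse N i y v) / 2"
    unfolding m_def by (rule mse_midpoint_less[OF assms(1)])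
  with assms(2)[of m] assms(3)[of m] show False
    by simp
qed

text \<open>Differentiability is over the reals: the conjugation inside \<open>hdot\<close> is a
  bounded real-linear map, though not a holomorphic one.\<close>

lemma differentiable_mse:
  fixes v :: "'a::real_normed_vector \<Rightarrow> complex^'m^'q::finite^'i::finite"
  assumes x: "x differentiable (at z)" and v: "\<And>j q. (\<lambda>z. v z $ j $ q) differentiable (at z)"
  shows "(\<lambda>z. mse N i (x z) (v z)) differentiable (at z)"
proof -
  have xr: "(\<lambda>z. x z $ r) differentiable (at z)" for r
    by (rule differentiable_vec_nth[OF x])
  have hdot: "(\<lambda>z. hdot (x z) (received N i j (v z))) differentiable (at z)" for j
    unfolding hdot_def received_def sum_component matrix_vector_mult_def vec_lambda_beta
    by (intro differentiable_sum ballI differentiable_mult differentiable_const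
        differentiable_bounded_linear[OF bounded_linear_cnj] xr differentiable_vec_nth[OF v]) simp_all
  \<comment> \<open>\<open>cmod\<close> is not differentiable at 0; its square, a sum of squares of
    real and imaginary part, is.\<close>
  have sq: "(\<lambda>z. (cmod (f z))\<^sup>2) differentiable (at z)" if "f differentiable (at z)" for f :: "'a \<Rightarrow> complex"
    unfolding cmod_power2
    by (intro differentiable_add differentiable_power that
        differentiable_bounded_linear[OF bounded_linear_Re] differentiable_bounded_linear[OF bounded_linear_Im])
  have "(\<lambda>z. (norm (x z))\<^sup>2) differentiable (at z)"
    unfolding norm_vec_def L2_set_def
    by (simp add: sum_nonneg) (intro differentiable_sum ballI sq xr, simp)
  then show ?thesis
    unfolding mse_def
    by (intro differentiable_add differentiable_mult differentiable_const differentiable_sum ballI sq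
        differentiable_diff hdot) auto
qed

text \<open>Outside the ball of radius \<open>1 / sqrt (noise N i)\<close> the noise term alone
  reaches 1, the error at 0, so a minimum over the compact ball is global.\<close>

lemma mse_minimizer_exists:
  assumes "0 < noise N i"
  shows "\<exists>x. \<forall>y. mse N i x v \<le> mse N i y v"
proof -
  have "continuous_on (cball 0 (1 / sqrt (noise N i))) (\<lambda>x. mse N i x v)"
    by (intro differentiable_imp_continuous_on differentiable_at_imp_differentiable_on
        differentiable_mse) auto
  then have "\<exists>x\<in>cball 0 (1 / sqrt (noise N i)).
      \<forall>y\<in>cball 0 (1 / sqrt (noise N i)). mse N i x v \<le> mse N i y v"
    using assms by (intro continuous_attains_inf) auto
  then obtain x where x: "\<And>y. y \<in> cball 0 (1 / sqrt (noise N i)) \<Longrightarrow> mse N i x v \<le> mse N i y v"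
    by blast
  have "mse N i x v \<le> mse N i y v" for y
  proof (cases "y \<in> cball 0 (1 / sqrt (noise N i))")
    case False
    then have "(1 / sqrt (noise N i))\<^sup>2 \<le> (norm y)\<^sup>2"
      using assms by (intro power_mono) auto
    then have "1 \<le> noise N i * (norm y)\<^sup>2"
      using assms by (simp add: power_divide field_simps)
    moreover have "mse N i x v \<le> 1"
      using x[of 0] assms by simp
    ultimately show ?thesis
      using mse_ge_noise[of N i y v] by linarith
  qed (rule x)
  then show ?thesis by blast
qed

section \<open>Block coordinate descent for the sparse beamforming problem\<close>

text \<open>The open orthant, in contrast to the closed one in \<open>feasible\<close>: the
  objective is finite only there.\<close>

definition weight_set :: "(real^'i) set" where
  "weight_set = {w. \<forall>i. 0 < w $ i}"

definition beam_set ::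
  "('k, 'q::finite, 'i::finite, 'm::finite, 'n::finite) network \<Rightarrow> (complex^'m^'q^'i) set" where
  "beam_set N = {v. (\<forall>q. (\<Sum>i | user_cell N i = bs_cell N q. (norm (v $ i $ q))\<^sup>2) \<le> budget N q)
    \<and> (\<forall>i q. user_cell N i \<noteq> bs_cell N q \<longrightarrow> v $ i $ q = 0)}"

definition amplitude_set :: "(real^'q) set" where
  "amplitude_set = {a. \<forall>q. (a $ q)\<^sup>2 \<le> 1}"

text \<open>The part that couples the blocks, separated from the absolute values because it is
  differentiable at positive weights.\<close>

definition smooth_cost ::
  "('k, 'q::finite, 'i::finite, 'm::finite, 'n::finite) network
    \<Rightarrow> ('q, 'i, 'm, 'n) point \<Rightarrow> real" where
  "smooth_cost N = (\<lambda>(u, w, v, a).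
     \<Sum>i\<in>UNIV. w $ i * mse N i (u $ i) (scaled a v) - ln (w $ i))"

definition penalty_cost ::
  "('k, 'q::finite, 'i::finite, 'm::finite, 'n::finite) network \<Rightarrow> real^'q \<Rightarrow> real" where
  "penalty_cost N a = (\<Sum>q\<in>UNIV. penalty N q * \<bar>a $ q\<bar>)"

definition cost ::
  "('k, 'q::finite, 'i::finite, 'm::finite, 'n::finite) network
    \<Rightarrow> ('q, 'i, 'm, 'n) point \<Rightarrow> real" where
  "cost N = (\<lambda>(u, w, v, a). smooth_cost N (u, w, v, a) + penalty_cost N a)"

lemma feasible_iff:
  "feasible N (u, w, v, a) \<longleftrightarrow> (\<forall>i. 0 \<le> w $ i) \<and> v \<in> beam_set N \<and> a \<in> amplitude_set"
  by (auto simp: feasible_def beam_set_def amplitude_set_def)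

lemma objective_eq:
  "objective N (u, w, v, a) =
    (if w \<in> weight_set \<and> v \<in> beam_set N \<and> a \<in> amplitude_set
     then ereal (cost N (u, w, v, a)) else \<infinity>)"
  by (auto simp: objective_def feasible_iff weight_set_def cost_def smooth_cost_def
      penalty_cost_def less_imp_le)

text \<open>If some weight vanishes, the objective is infinite for every \<open>u\<close>, so \<open>u'\<close> is arbitrary.\<close>

lemma bcd_cycle_iff:
  fixes N :: "('k, 'q::finite, 'i::finite, 'm::finite, 'n::finite) network"
  assumes "v \<in> beam_set N" "a \<in> amplitude_set"
  shows "bcd_cycle N (u, w, v, a) (u', w', v', a') \<longleftrightarrow>
    (w \<in> weight_set \<longrightarrow> (\<forall>y. cost N (u', w, v, a) \<le> cost N (y, w, v, a)))
    \<and> w' \<in> weight_set \<and> (\<forall>y\<in>weight_set. cost N (u', w', v, a) \<le> cost N (u', y, v, a))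
    \<and> v' \<in> beam_set N \<and> (\<forall>y\<in>beam_set N. cost N (u', w', v', a) \<le> cost N (u', w', y, a))
    \<and> a' \<in> amplitude_set
    \<and> (\<forall>y\<in>amplitude_set. cost N (u', w', v', a') \<le> cost N (u', w', v', y))"
proof -
  have 1: "is_arg_min (\<lambda>x. objective N (x, w, v, a)) (\<lambda>_. True) u'
      \<longleftrightarrow> (w \<in> weight_set \<longrightarrow> (\<forall>y. cost N (u', w, v, a) \<le> cost N (y, w, v, a)))"
    using assms by (auto simp: is_arg_min_def objective_eq not_less)
  have 2: "is_arg_min (\<lambda>x. objective N (u', x, v, a)) (\<lambda>_. True) w'
      \<longleftrightarrow> w' \<in> weight_set \<and> (\<forall>y\<in>weight_set. cost N (u', w', v, a) \<le> cost N (u', y, v, a))"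
  proof -
    have "(\<chi> i. 1) \<in> (weight_set :: (real^'i) set)"
      by (simp add: weight_set_def)
    then have "(weight_set :: (real^'i) set) \<noteq> {}"
      by blast
    from is_arg_min_extended_iff[OF this, of "\<lambda>x. cost N (u', x, v, a)" w'] show ?thesis
      using assms by (simp add: objective_eq)
  qed
  \<comment> \<open>Finiteness in this block presupposes positive weights; the second equivalence
    supplies them when all four are combined.\<close>
  have 3: "is_arg_min (\<lambda>x. objective N (u', w', x, a)) (\<lambda>_. True) v'
      \<longleftrightarrow> v' \<in> beam_set N \<and> (\<forall>y\<in>beam_set N. cost N (u', w', v', a) \<le> cost N (u', w', y, a))"
    if "w' \<in> weight_set"
  proof -
    have "beam_set N \<noteq> {}"
      using assms by blast
    from is_arg_min_extended_iff[OF this, of "\<lambda>x. cost N (u', w', x, a)" v'] show ?thesis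
      using assms that by (simp add: objective_eq)
  qed
  have 4: "is_arg_min (\<lambda>x. objective N (u', w', v', x)) (\<lambda>_. True) a'
      \<longleftrightarrow> a' \<in> amplitude_set
        \<and> (\<forall>y\<in>amplitude_set. cost N (u', w', v', a') \<le> cost N (u', w', v', y))"
    if "w' \<in> weight_set" "v' \<in> beam_set N"
  proof -
    have "(amplitude_set :: (real^'q) set) \<noteq> {}"
      using assms by blast
    from is_arg_min_extended_iff[OF this, of "\<lambda>x. cost N (u', w', v', x)" a'] show ?thesis
      using that by (simp add: objective_eq)
  qed
  show ?thesis
    unfolding bcd_cycle_def prod.case 1 2 using 3 4 by blast
qed

section \<open>Compactness of the amplitude and beamformer sets\<close>

lemma compact_amplitude_set: "compact (amplitude_set :: (real^'q) set)"
proof -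
  have "closed (amplitude_set :: (real^'q) set)"
    unfolding amplitude_set_def by (intro closed_Collect_all closed_Collect_le continuous_intros)
  moreover have "bounded (amplitude_set :: (real^'q) set)"
    by (rule bounded_vecI[where B = "\<lambda>_. 1"]) (simp add: amplitude_set_def abs_square_le_1)
  ultimately show ?thesis
    by (simp add: compact_eq_bounded_closed)
qed

lemma norm_beam_le:
  assumes "v \<in> beam_set N" "\<And>q. 0 < budget N q"
  shows "norm (v $ i $ q) \<le> sqrt (budget N q)"
proof (cases "user_cell N i = bs_cell N q")
  case True
  then have "(norm (v $ i $ q))\<^sup>2 \<le> (\<Sum>i | user_cell N i = bs_cell N q. (norm (v $ i $ q))\<^sup>2)"
    by (intro member_le_sum) auto
  also have "\<dots> \<le> budget N q"
    using assms(1) by (simp add: beam_set_def)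
  finally show ?thesis
    by (simp add: real_le_rsqrt)
next
  case False
  then show ?thesis
    using assms(1) assms(2)[of q] by (simp add: beam_set_def)
qed

lemma compact_beam_set:
  fixes N :: "('k, 'q::finite, 'i::finite, 'm::finite, 'n::finite) network"
  assumes "\<And>q. 0 < budget N q"
  shows "compact (beam_set N)"
proof -
  \<comment> \<open>The conditional padding equations become an intersection of coordinate zero
    sets, each of them closed.\<close>
  have eq: "beam_set N = {v. (\<forall>q. (\<Sum>i | user_cell N i = bs_cell N q. (norm (v $ i $ q))\<^sup>2) \<le> budget N q)}
      \<inter> (\<Inter>(i, q)\<in>{(i, q). user_cell N i \<noteq> bs_cell N q}. {v. v $ i $ q = 0})"
    by (auto simp: beam_set_def)
  have "closed (beam_set N)"
    unfolding eq
    by (intro closed_Int closed_Collect_all closed_Collect_le continuous_intros closed_INT ballI)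
      (auto intro!: closed_Collect_eq continuous_intros)
  moreover have "bounded (beam_set N)"
  proof (rule bounded_vecI)
    fix v i
    assume v: "v \<in> beam_set N"
    have "norm (v $ i) \<le> (\<Sum>q\<in>UNIV. norm (v $ i $ q))"
      unfolding norm_vec_def[of "v $ i"] by (rule L2_set_le_sum) simp
    also have "\<dots> \<le> (\<Sum>q\<in>UNIV. sqrt (budget N q))"
      by (intro sum_mono norm_beam_le[OF v assms])
    finally show "norm (v $ i) \<le> (\<Sum>q\<in>UNIV. sqrt (budget N q))" .
  qed
  ultimately show ?thesis
    by (simp add: compact_eq_bounded_closed)
qed

section \<open>Smoothness of the cost and a uniform lower bound on the errors\<close>

lemma differentiable_mse_scaled:
  assumes "x differentiable (at z)" "v differentiable (at z)" "a differentiable (at z)"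
  shows "(\<lambda>z. mse N i (x z) (scaled (a z) (v z))) differentiable (at z)"
  by (rule differentiable_mse)
    (simp_all add: scaled_def assms differentiable_scaleR differentiable_vec_nth)

lemma differentiable_smooth_cost:
  fixes u :: "complex^'n^'i"
  assumes "w \<in> weight_set"
  shows "smooth_cost N differentiable (at (u, w, v, a))"
proof -
  have ln: "(\<lambda>z. ln (f z)) differentiable (at x)"
    if "f differentiable (at x)" "0 < f x" for f :: "'z::real_normed_vector \<Rightarrow> real" and x
    using that unfolding differentiable_def by (blast intro: has_derivative_ln)
  have w: "(\<lambda>z::(complex^'n^'i) \<times> (real^'i) \<times> 'z::real_normed_vector. fst (snd z) $ i) differentiable (at x)" for i x
    by (intro differentiable_vec_nth bounded_linear_imp_differentiable
        bounded_linear_fst_comp bounded_linear_snd)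
  have "(\<lambda>z. \<Sum>i\<in>UNIV. fst (snd z) $ i
        * mse N i (fst z $ i) (scaled (snd (snd (snd z))) (fst (snd (snd z)))) - ln (fst (snd z) $ i))
      differentiable (at (u, w, v, a))"
    using assms
    by (intro differentiable_sum ballI differentiable_diff differentiable_mult ln w
        differentiable_mse_scaled differentiable_vec_nth bounded_linear_imp_differentiable
        bounded_linear_fst_comp bounded_linear_snd_comp bounded_linear_fst bounded_linear_snd)
      (simp_all add: weight_set_def)
  then show ?thesis
    by (simp add: smooth_cost_def case_prod_beta')
qed

lemma continuous_on_cost:
  "continuous_on (UNIV \<times> weight_set \<times> V \<times> A) (cost N)"
proof -
  have "continuous_on (UNIV \<times> weight_set \<times> V \<times> A) (smooth_cost N)"
    by (intro differentiable_imp_continuous_on differentiable_at_imp_differentiable_on)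
      (auto intro: differentiable_smooth_cost)
  moreover have "cost N = (\<lambda>z. smooth_cost N z + penalty_cost N (snd (snd (snd z))))"
    by (auto simp: cost_def)
  ultimately show ?thesis
    unfolding penalty_cost_def by (auto intro!: continuous_intros)
qed

text \<open>The minimum over a compact product is attained, hence positive. Optimal weights are
  reciprocal errors, so this bounds them from above.\<close>

lemma mse_pos_on_compact:
  fixes N :: "('k, 'q::finite, 'i::finite, 'm::finite, 'n::finite) network"
  assumes "\<And>i. 0 < noise N i" and "compact X" "compact V" "compact A"
  shows "\<exists>c>0. \<forall>x\<in>X. \<forall>v\<in>V. \<forall>a\<in>A. c \<le> mse N i x (scaled a v)"
proof (cases "X \<times> V \<times> A = {}")
  case False
  have "continuous_on (X \<times> V \<times> A) (\<lambda>z. mse N i (fst z) (scaled (snd (snd z)) (fst (snd z))))"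
    by (intro differentiable_imp_continuous_on differentiable_at_imp_differentiable_on
        differentiable_mse_scaled bounded_linear_imp_differentiable
        bounded_linear_fst_comp bounded_linear_snd_comp bounded_linear_fst bounded_linear_snd)
  then obtain z where "z \<in> X \<times> V \<times> A" and "\<forall>y\<in>X \<times> V \<times> A.
      mse N i (fst z) (scaled (snd (snd z)) (fst (snd z)))
      \<le> mse N i (fst y) (scaled (snd (snd y)) (fst (snd y)))"
    using continuous_attains_inf[OF compact_Times[OF assms(2) compact_Times[OF assms(3,4)]] False]
    by blast
  then show ?thesis
    using mse_pos[of N i, OF assms(1)] by (intro exI[of _ "mse N i (fst z) (scaled (snd (snd z)) (fst (snd z)))"]) force
qed (auto intro: exI[of _ 1])

section \<open>Optimality conditions in the first two blocks\<close>

text \<open>Each error involves only its own receive beamformer and carries a positive weight, so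
  minimizing the sum means minimizing every error separately.\<close>

lemma cost_min_u_iff:
  assumes "w \<in> weight_set"
  shows "(\<forall>y. cost N (u, w, v, a) \<le> cost N (y, w, v, a))
    \<longleftrightarrow> (\<forall>i x. mse N i (u $ i) (scaled a v) \<le> mse N i x (scaled a v))" (is "?L \<longleftrightarrow> ?R")
proof
  assume L: ?L
  show ?R
  proof (intro allI)
    fix i x
    let ?S = "\<lambda>u. \<Sum>j\<in>UNIV - {i}. w $ j * mse N j (u $ j) (scaled a v) - ln (w $ j)"
    \<comment> \<open>Altering a single coordinate leaves the summands of all other users
      fixed.\<close>
    define y where "y = (\<chi> j. if j = i then x else u $ j)"
    have split: "smooth_cost N (u, w, v, a)
        = w $ i * mse N i (u $ i) (scaled a v) - ln (w $ i) + ?S u" for u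
      unfolding smooth_cost_def prod.case by (rule sum.remove) simp_all
    have "?S y = ?S u"
      by (rule sum.cong) (simp_all add: y_def)
    then have "w $ i * mse N i (u $ i) (scaled a v) \<le> w $ i * mse N i x (scaled a v)"
      using L[rule_format, of y] by (simp add: cost_def split) (simp add: y_def)
    then show "mse N i (u $ i) (scaled a v) \<le> mse N i x (scaled a v)"
      using assms by (simp add: weight_set_def)
  qed
next
  assume ?R
  then show ?L
    using assms by (auto simp: cost_def smooth_cost_def weight_set_def less_imp_le
        intro!: sum_mono mult_left_mono)
qed

text \<open>The penalty does not depend on \<open>w\<close>, so this is
  \<open>weights_min_iff\<close> for the vector of mean square errors.\<close>

lemma cost_min_w_iff:
  assumes "\<And>i. 0 < noise N i" "w \<in> weight_set"
  shows "(\<forall>y\<in>weight_set. cost N (u, w, v, a) \<le> cost N (u, y, v, a))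
    \<longleftrightarrow> (\<forall>i. w $ i * mse N i (u $ i) (scaled a v) = 1)"
  using weights_min_iff[of "\<chi> i. mse N i (u $ i) (scaled a v)" w] assms
  by (simp add: cost_def smooth_cost_def weight_set_def mse_pos Ball_def)

section \<open>Existence of runs\<close>

text \<open>The noise term makes the errors coercive in \<open>u\<close>, the optimal weights are
  explicit, and the last two blocks range over compact sets.\<close>

lemma bcd_cycle_exists:
  fixes N :: "('k, 'q::finite, 'i::finite, 'm::finite, 'n::finite) network"
  assumes noise: "\<And>i. 0 < noise N i" and "\<And>q. 0 < budget N q" and "feasible N z"
  shows "\<exists>z'. feasible N z' \<and> bcd_cycle N z z'"
proof -
  obtain u w v a where z: "z = (u, w, v, a)"
    by (cases z) auto
  have v: "v \<in> beam_set N" and a: "a \<in> amplitude_set"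
    using assms(3) by (simp_all add: z feasible_iff)
  have "\<forall>i. \<exists>x. \<forall>y. mse N i x (scaled a v) \<le> mse N i y (scaled a v)"
    by (intro allI mse_minimizer_exists noise)
  from choice[OF this] obtain m
    where m: "\<And>i y. mse N i (m i) (scaled a v) \<le> mse N i y (scaled a v)"
    by blast
  define u' where "u' = (\<chi> i. m i)"
  define w' where "w' = (\<chi> i. 1 / mse N i (u' $ i) (scaled a v))"
  have w': "w' \<in> weight_set" "\<And>i. w' $ i * mse N i (u' $ i) (scaled a v) = 1"
    using mse_pos[OF noise] by (simp_all add: w'_def weight_set_def less_imp_neq[symmetric])
  have cont: "continuous_on S (\<lambda>y. cost N (f y))"
    if "continuous_on S f" "f ` S \<subseteq> UNIV \<times> weight_set \<times> UNIV \<times> UNIV" for S :: "'z::topological_space set" and f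
    using continuous_on_compose2[OF continuous_on_cost that] .
  have "\<exists>v'\<in>beam_set N. \<forall>y\<in>beam_set N. cost N (u', w', v', a) \<le> cost N (u', w', y, a)"
    using v w'(1)
    by (intro continuous_attains_inf compact_beam_set assms cont continuous_intros) auto
  then obtain v' where v': "v' \<in> beam_set N"
    "\<forall>y\<in>beam_set N. cost N (u', w', v', a) \<le> cost N (u', w', y, a)" by blast
  have "\<exists>a'\<in>amplitude_set. \<forall>y\<in>amplitude_set. cost N (u', w', v', a') \<le> cost N (u', w', v', y)"
    using a w'(1)
    by (intro continuous_attains_inf compact_amplitude_set cont continuous_intros) auto
  then obtain a' where a': "a' \<in> amplitude_set"
    "\<forall>y\<in>amplitude_set. cost N (u', w', v', a') \<le> cost N (u', w', v', y)" by blast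
  have "bcd_cycle N z (u', w', v', a')"
    unfolding z bcd_cycle_iff[OF v a] cost_min_w_iff[OF noise w'(1)]
    using v' a' w' m by (auto simp: cost_min_u_iff u'_def)
  moreover have "feasible N (u', w', v', a')"
    using w' v' a' by (simp add: feasible_iff weight_set_def less_imp_le)
  ultimately show ?thesis by blast
qed

lemma bcd_run_exists:
  fixes N :: "('k, 'q::finite, 'i::finite, 'm::finite, 'n::finite) network"
  assumes "\<And>i. 0 < noise N i" "\<And>q. 0 < budget N q" "feasible N z"
  shows "\<exists>x. bcd_run N x \<and> x 0 = z"
proof -
  \<comment> \<open>Feasibility is carried along so that a further cycle always exists; the
    implication pins the starting point.\<close>
  have "\<exists>x. \<forall>t. (feasible N (x t) \<and> (t = 0 \<longrightarrow> x t = z)) \<and> bcd_cycle N (x t) (x (Suc t))"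
    using assms(3) bcd_cycle_exists[OF assms(1,2)]
    by (intro dependent_nat_choice) blast+
  then show ?thesis
    unfolding bcd_run_def by blast
qed

section \<open>Convergence of runs\<close>

text \<open>From index 2 on the iterates obey uniform bounds. The truncated run fits
  \<open>bcd_cluster_point\<close>, and its cluster points fall under
  \<open>blockwise_min_stationary\<close>.\<close>

lemma bcd_run_converges:
  fixes N :: "('k::finite, 'q::finite, 'i::finite, 'm::finite, 'n::finite) network"
  assumes noise: "\<And>i. 0 < noise N i" and budget: "\<And>q. 0 < budget N q" and run: "bcd_run N x"
  shows "converges_to_set x {z. stationary_point (objective N) z}"
proof -
  define u where "u t = fst (x t)" for t
  define w where "w t = fst (snd (x t))" for t
  define v where "v t = fst (snd (snd (x t)))" for t
  define a where "a t = snd (snd (snd (x t)))" for t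
  have x: "x t = (u t, w t, v t, a t)" for t
    by (simp add: u_def w_def v_def a_def)
  have va: "v t \<in> beam_set N \<and> a t \<in> amplitude_set" for t
  proof (induction t)
    case 0
    then show ?case
      using run by (simp add: bcd_run_def x feasible_iff)
  next
    case (Suc t)
    have "bcd_cycle N (u t, w t, v t, a t) (u (Suc t), w (Suc t), v (Suc t), a (Suc t))"
      using run by (simp add: bcd_run_def x)
    then show ?case
      using Suc by (simp add: bcd_cycle_iff)
  qed
  then have v: "v t \<in> beam_set N" and a: "a t \<in> amplitude_set" for t
    by auto
  have "bcd_cycle N (u t, w t, v t, a t) (u (Suc t), w (Suc t), v (Suc t), a (Suc t))" for t
    using run by (simp add: bcd_run_def x)
  note cyc = this[unfolded bcd_cycle_iff[OF v a]]
  \<comment> \<open>The starting point may have vanishing weights, but the first weight update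
    removes them; the update of \<open>u\<close> is therefore exploited from the second cycle
    on.\<close>
  have wpos: "w (Suc t) \<in> weight_set" for t
    using cyc by blast
  have step_u: "cost N (u (Suc (Suc t)), w (Suc t), v (Suc t), a (Suc t))
      \<le> cost N (y, w (Suc t), v (Suc t), a (Suc t))" for t y
    using cyc wpos by blast
  have step_w: "y \<in> weight_set \<Longrightarrow>
      cost N (u (Suc t), w (Suc t), v t, a t) \<le> cost N (u (Suc t), y, v t, a t)" for t y
    using cyc by blast
  have step_v: "y \<in> beam_set N \<Longrightarrow>
      cost N (u (Suc t), w (Suc t), v (Suc t), a t) \<le> cost N (u (Suc t), w (Suc t), y, a t)" for t y
    using cyc by blast
  have step_a: "y \<in> amplitude_set \<Longrightarrow> cost N (u (Suc t), w (Suc t), v (Suc t), a (Suc t))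
      \<le> cost N (u (Suc t), w (Suc t), v (Suc t), y)" for t y
    using cyc by blast
  have mse_le_1: "mse N i (u (Suc (Suc t)) $ i) (scaled (a (Suc t)) (v (Suc t))) \<le> 1" for i t
    using step_u cost_min_u_iff[OF wpos] mse_0 by metis
  \<comment> \<open>Weights are updated before \<open>v\<close> and \<open>a\<close>, so the error
    is taken at the old \<open>v t\<close> and \<open>a t\<close>.\<close>
  have w_mse: "w (Suc t) $ i * mse N i (u (Suc t) $ i) (scaled (a t) (v t)) = 1" for i t
    using step_w cost_min_w_iff[OF noise wpos] by blast
  have u_le: "norm (u (Suc (Suc t)) $ i) \<le> 1 / sqrt (noise N i)" for i t
  proof -
    have "noise N i * (norm (u (Suc (Suc t)) $ i))\<^sup>2 \<le> 1"
      using mse_ge_noise mse_le_1 by (rule order_trans)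
    then have "(norm (u (Suc (Suc t)) $ i))\<^sup>2 \<le> 1 / noise N i"
      using noise[of i] by (simp add: field_simps)
    then show ?thesis
      by (metis real_le_rsqrt real_sqrt_divide real_sqrt_one)
  qed
  have w_ge: "1 \<le> w (Suc (Suc t)) $ i" for i t
  proof -
    have pos: "0 < w (Suc (Suc t)) $ i"
      using wpos by (simp add: weight_set_def)
    have "1 = w (Suc (Suc t)) $ i * mse N i (u (Suc (Suc t)) $ i) (scaled (a (Suc t)) (v (Suc t)))"
      using w_mse by simp
    also have "\<dots> \<le> w (Suc (Suc t)) $ i * 1"
      using pos mse_le_1 by (intro mult_left_mono) auto
    finally show ?thesis by simp
  qed
  have "\<exists>c>0. \<forall>x\<in>cball 0 (1 / sqrt (noise N i)). \<forall>v\<in>beam_set N. \<forall>a\<in>amplitude_set.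
      c \<le> mse N i x (scaled a v)" for i
    by (intro mse_pos_on_compact noise compact_cball compact_beam_set budget compact_amplitude_set)
  then obtain c where c: "\<And>i. 0 < c i" and c_le: "\<And>i x v a. norm x \<le> 1 / sqrt (noise N i) \<Longrightarrow>
      v \<in> beam_set N \<Longrightarrow> a \<in> amplitude_set \<Longrightarrow> c i \<le> mse N i x (scaled a v)"
    by (metis mem_cball_0)
  have w_le: "norm (w (Suc (Suc t)) $ i) \<le> 1 / c i" for i t
  proof -
    have "w (Suc (Suc t)) $ i * c i
        \<le> w (Suc (Suc t)) $ i * mse N i (u (Suc (Suc t)) $ i) (scaled (a (Suc t)) (v (Suc t)))"
      using w_ge[of t i] by (intro mult_left_mono c_le u_le v a) simp
    then have "w (Suc (Suc t)) $ i * c i \<le> 1"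
      by (simp add: w_mse)
    then show ?thesis
      using c[of i] w_ge[of t i] by (simp add: field_simps)
  qed
  define s where "s t = x (Suc (Suc t))" for t
  have bnd_s: "bounded (range s)"
  proof (rule bounded_subset)
    let ?U = "range (\<lambda>t. u (Suc (Suc t)))" and ?W = "range (\<lambda>t. w (Suc (Suc t)))"
    have "bounded ?U"
      by (rule bounded_vecI) (use u_le in auto)
    moreover have "bounded ?W"
      by (rule bounded_vecI) (use w_le in auto)
    ultimately show "bounded (?U \<times> ?W \<times> beam_set N \<times> amplitude_set)"
      by (intro bounded_Times compact_imp_bounded[OF compact_beam_set[OF budget]]
          compact_imp_bounded[OF compact_amplitude_set])
    show "range s \<subseteq> ?U \<times> ?W \<times> beam_set N \<times> amplitude_set"
      using v a by (auto simp: s_def x)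
  qed
  show ?thesis
  proof (rule converges_to_setI)
    have "range x \<subseteq> insert (x 0) (insert (x 1) (range s))"
    proof
      fix y assume "y \<in> range x"
      then obtain t where t: "y = x t" by blast
      have "t = 0 \<or> t = 1 \<or> (\<exists>k. t = Suc (Suc k))"
        by presburger
      then show "y \<in> insert (x 0) (insert (x 1) (range s))"
        unfolding t by (auto simp: s_def)
    qed
    then show "bounded (range x)"
      by (rule bounded_subset[rotated]) (simp add: bnd_s)
  next
    fix z r
    assume r: "strict_mono r" and lim: "(x \<circ> r) \<longlonglongrightarrow> z"
    obtain u0 w0 v0 a0 where z: "z = (u0, w0, v0, a0)"
      by (cases z) auto
    \<comment> \<open>Strict monotonicity gives \<open>r (n + 2) \<ge> n + 2\<close>, so the
      subtraction on naturals is exact.\<close>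
    define r' where "r' n = r (n + 2) - 2" for n
    have rr: "Suc (Suc (r' n)) = r (n + 2)" for n
      using strict_mono_imp_increasing[OF r, of "n + 2"] by (simp add: r'_def)
    have r': "strict_mono r'"
    proof (rule strict_monoI)
      fix m n :: nat assume "m < n"
      then have "r (m + 2) < r (n + 2)"
        using r by (simp add: strict_mono_def)
      then show "r' m < r' n"
        using rr[of m] rr[of n] by simp
    qed
    have "(\<lambda>n. (x \<circ> r) (n + 2)) \<longlonglongrightarrow> z"
      by (rule LIMSEQ_ignore_initial_segment[OF lim])
    then have lim': "(\<lambda>n. (u (Suc (Suc (r' n))), w (Suc (Suc (r' n))), v (Suc (Suc (r' n))),
        a (Suc (Suc (r' n))))) \<longlonglongrightarrow> (u0, w0, v0, a0)"
      by (simp only: rr o_apply x z)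
    \<comment> \<open>The closed set of weights at least 1 lies inside the open
      \<open>weight_set\<close> and keeps the limiting weights positive.\<close>
    have "w0 \<in> {w. \<forall>i. 1 \<le> w $ i} \<and> v0 \<in> beam_set N \<and> a0 \<in> amplitude_set
      \<and> (\<forall>y. cost N (u0, w0, v0, a0) \<le> cost N (y, w0, v0, a0))
      \<and> (\<forall>y\<in>weight_set. cost N (u0, w0, v0, a0) \<le> cost N (u0, y, v0, a0))
      \<and> (\<forall>y\<in>beam_set N. cost N (u0, w0, v0, a0) \<le> cost N (u0, w0, y, a0))
      \<and> (\<forall>y\<in>amplitude_set. cost N (u0, w0, v0, a0) \<le> cost N (u0, w0, v0, y))"
    proof (rule bcd_cluster_point[OF _ _ _ _ _ _ _ _ _ step_u step_w step_v step_a _ _ r' lim'])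
      show "closed {w :: real^'i. \<forall>i. 1 \<le> w $ i}"
        by (intro closed_Collect_all closed_Collect_le continuous_intros)
      show "{w :: real^'i. \<forall>i. 1 \<le> w $ i} \<subseteq> weight_set"
        by (auto simp: weight_set_def intro: less_le_trans[OF zero_less_one])
      show "bounded (range (\<lambda>t. (u (Suc (Suc t)), w (Suc (Suc t)), v (Suc (Suc t)), a (Suc (Suc t)))))"
        using bnd_s by (simp add: s_def x)
    next
      fix u u' w v a
      assume w: "w \<in> weight_set" and min: "\<And>y. cost N (u, w, v, a) \<le> cost N (y, w, v, a)"
        and eq: "cost N (u', w, v, a) = cost N (u, w, v, a)"
      have "\<forall>y. cost N (u', w, v, a) \<le> cost N (y, w, v, a)"
        using min eq by simp
      with min show "u' = u"
        unfolding cost_min_u_iff[OF w] vec_eq_iff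
        using mse_minimizer_unique[OF noise] cost_min_u_iff[OF w] by metis
    next
      fix u w w' v a
      assume w: "w \<in> weight_set" "w' \<in> weight_set"
        and min: "\<And>y. y \<in> weight_set \<Longrightarrow> cost N (u, w, v, a) \<le> cost N (u, y, v, a)"
        and eq: "cost N (u, w', v, a) = cost N (u, w, v, a)"
      have "\<forall>i. w $ i * mse N i (u $ i) (scaled a v) = 1"
        using min cost_min_w_iff[OF noise w(1)] by blast
      moreover have "\<forall>i. w' $ i * mse N i (u $ i) (scaled a v) = 1"
        using min eq cost_min_w_iff[OF noise w(2), of u v a] by simp
      ultimately show "w' = w"
        unfolding vec_eq_iff by (metis mult_cancel_right zero_neq_one mult_zero_right)
    qed (use w_ge v a compact_beam_set[OF budget] compact_amplitude_set in
        \<open>auto intro: continuous_on_cost compact_imp_closed\<close>)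
    then have lim_mem: "w0 \<in> weight_set" "v0 \<in> beam_set N" "a0 \<in> amplitude_set"
      and min: "\<And>y. cost N (u0, w0, v0, a0) \<le> cost N (y, w0, v0, a0)"
      "\<And>y. y \<in> weight_set \<Longrightarrow> cost N (u0, w0, v0, a0) \<le> cost N (u0, y, v0, a0)"
      "\<And>y. y \<in> beam_set N \<Longrightarrow> cost N (u0, w0, v0, a0) \<le> cost N (u0, w0, y, a0)"
      "\<And>y. y \<in> amplitude_set \<Longrightarrow> cost N (u0, w0, v0, a0) \<le> cost N (u0, w0, v0, y)"
      by (auto simp: weight_set_def intro: less_le_trans[OF zero_less_one])
    \<comment> \<open>The penalty depends on \<open>a\<close> alone, so it cancels from the
      inequalities of the other three blocks.\<close>
    have "stationary_point (objective N) (u0, w0, v0, a0)"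
      by (rule blockwise_min_stationary[where f = "smooth_cost N" and g = "penalty_cost N",
            OF _ differentiable_smooth_cost lim_mem])
        (use lim_mem min in \<open>simp_all add: objective_eq cost_def\<close>)
    then show "z \<in> {z. stationary_point (objective N) z}"
      by (simp add: z)
  qed
qed

text \<open>The first conjunct provides runs from every feasible start, so that the second is not
  vacuous.\<close>

theorem theorem3:
  fixes N :: "('k::finite, 'q::finite, 'i::finite, 'm::finite, 'n::finite) network"
  assumes "\<And>i. 0 < noise N i"
    and "\<And>q. 0 < budget N q"
    and "\<And>q. 0 \<le> penalty N q"
  shows "(\<forall>z. feasible N z \<longrightarrow> (\<exists>x. bcd_run N x \<and> x 0 = z))
    \<and> (\<forall>x. bcd_run N x \<longrightarrow> converges_to_set x {z. stationary_point (objective N) z})"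
  using bcd_run_exists[OF assms(1,2)] bcd_run_converges[OF assms(1,2)] by blast

end
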